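(* Let $S$ be a numerical semigroup with embedding dimension three such that $S$ has exactly one Betti element, i.e. $\#\mathrm{Betti}(S)=1$. Then $$\max(\Delta(S))+2<\mathrm{c}(S),$$ where $\Delta(S)$ is the Delta set of $S$ and $\mathrm{c}(S)$ is the catenary degree of $S$.
   Context: $\mathbb{N}$ denotes the set of nonnegative integers. A numerical semigroup is a subset of $\mathbb{N}$ closed under addition, containing $0$, with finite complement in $\mathbb{N}$. Every numerical semigroup $S$ has a unique minimal system of generators $\{n_1<\dots<n_p\}$; we write $S=\langle n_1,\dots,n_p\rangle$, and $p$ is called the embedding dimension of $S$. For $s\in S$, the set of factorizations of $s$ is $\mathrm{Z}(s)=\{(a_1,\dots,a_p)\in\mathbb{N}^p \mid a_1n_1+\dots+a_pn_p=s\}$. The length of $x=(x_1,\dots,x_p)\in\mathbb{N}^p$ is $|x|=x_1+\dots+x_p$, and the set of lengths of $s$ is $\mathrm{L}(s)=\{|x| \mid x\in\mathrm{Z}(s)\}$, a finite set. If $\mathrm{L}(s)=\{l_1<\dots<l_k\}$, then $\Delta(s)=\{l_2-l_1,\dots,l_k-l_{k-1}\}$ (empty if $k=1$), and the Delta set of $S$ is $\Delta(S)=\bigcup_{s\in S}\Delta(s)$. For $x,y\in\mathbb{N}^p$, let $x\wedge y=(\min\{x_1,y_1\},\dots,\min\{x_p,y_p\})$ and $\mathrm{d}(x,y)=\max\{|x|,|y|\}-|x\wedge y|$. For $N\in\mathbb{N}$, an $N$-chain of factorizations of $s$ is a sequence $z_0,\dots,z_k\in\mathrm{Z}(s)$ with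 $\mathrm{d}(z_{i-1},z_i)\le N$ for all $i\in\{1,\dots,k\}$. The catenary degree $\mathrm{c}(s)$ of $s\in S$ is the least $N\in\mathbb{N}\cup\{\infty\}$ such that any two factorizations of $s$ are joined by an $N$-chain of factorizations of $s$. The catenary degree of $S$ is $\mathrm{c}(S)=\sup\{\mathrm{c}(s)\mid s\in S\}$. For $s\in S$, let $\nabla_s$ be the graph with vertex set $\mathrm{Z}(s)$ in which $a,b$ are joined by an edge if there is an index $i$ with $a_i\ne0$ and $b_i\neq 0$. An element $s\in S$ is a Betti element of $S$ if $\nabla_s$ is not connected; $\mathrm{Betti}(S)$ is the set of Betti elements of $S$. *)

theory Defs
  imports Complex_Main "HOL-Library.Extended_Nat"
begin

definition submonoid :: "nat set \<Rightarrow> bool" where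
  "submonoid T \<longleftrightarrow> 0 \<in> T \<and> (\<forall>x\<in>T. \<forall>y\<in>T. x + y \<in> T)"

definition numerical_semigroup :: "nat set \<Rightarrow> bool" where
  "numerical_semigroup S \<longleftrightarrow> submonoid S \<and> finite (UNIV - S)"

definition is_min_gens :: "nat set \<Rightarrow> nat set \<Rightarrow> bool" where
  "is_min_gens S A \<longleftrightarrow> submonoid hull A = S \<and> (\<forall>B. B \<subset> A \<longrightarrow> submonoid hull B \<noteq> S)"

text \<open>The description below is well defined: see \<open>ex1_is_min_gens\<close>.\<close>

definition min_gens :: "nat set \<Rightarrow> nat set" where
  "min_gens S = (THE A. is_min_gens S A)"

lemma ex1_is_min_gens:
  assumes "numerical_semigroup S"
  shows "\<exists>!A. is_min_gens S A"
proof -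
  define At where "At = {s\<in>S. s \<noteq> 0 \<and> \<not> (\<exists>x\<in>S - {0}. \<exists>y\<in>S - {0}. s = x + y)}"
  have S: "submonoid S"
    using assms by (simp add: numerical_semigroup_def)
  have sub_hull: "submonoid (submonoid hull A)" for A
    unfolding hull_def submonoid_def by blast
  have hull_0: "0 \<in> submonoid hull A" for A
    using sub_hull[of A] by (subst (asm) submonoid_def) blast
  have hull_add: "x + y \<in> submonoid hull A"
    if "x \<in> submonoid hull A" "y \<in> submonoid hull A" for x y A
    using sub_hull[of A] that by (subst (asm) submonoid_def) blast
  have At_least: "At \<subseteq> A" if A: "submonoid hull A = S" for A
  proof
    fix s assume s: "s \<in> At"
    show "s \<in> A"
    proof (rule ccontr)
      assume "s \<notin> A"
      moreover have "A \<subseteq> S"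
        using A hull_subset by metis
      moreover have "submonoid (S - {s})"
        unfolding submonoid_def
      proof (intro conjI ballI)
        show "0 \<in> S - {s}"
          using S s by (auto simp: submonoid_def At_def)
        fix x y assume "x \<in> S - {s}" "y \<in> S - {s}"
        then show "x + y \<in> S - {s}"
          using S s unfolding submonoid_def At_def
          by (cases "x = 0"; cases "y = 0") auto
      qed
      ultimately have "submonoid hull A \<subseteq> S - {s}"
        by (intro hull_minimal) auto
      then show False
        using A s by (auto simp: At_def)
    qed
  qed
  have gen: "s \<in> submonoid hull At" if "s \<in> S" for s
    using that
  proof (induction s rule: less_induct)
    case (less s)
    consider "s = 0" | "s \<in> At" | x y where "x \<in> S - {0}" "y \<in> S - {0}" "s = x + y"
      using less.prems unfolding At_def by blast
    then show ?case
    proof cases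
      case 1
      then show ?thesis using hull_0 by simp
    next
      case 2
      then show ?thesis by (rule hull_inc)
    next
      case 3
      then have "x \<in> submonoid hull At" "y \<in> submonoid hull At"
        using less.IH by auto
      then show ?thesis using 3 hull_add by simp
    qed
  qed
  have "submonoid hull At \<subseteq> S"
    by (rule hull_minimal) (use S in \<open>auto simp: At_def\<close>)
  with gen have At_gen: "submonoid hull At = S" by blast
  show ?thesis
  proof (rule ex1I)
    show "is_min_gens S At"
      using At_gen At_least unfolding is_min_gens_def by blast
    show "A = At" if "is_min_gens S A" for A
      using that At_gen At_least unfolding is_min_gens_def by blast
  qed
qed

definition gens :: "nat set \<Rightarrow> nat list" where
  "gens S = sorted_list_of_set (min_gens S)"

definition embedding_dim :: "nat set \<Rightarrow> nat" where
  "embedding_dim S = card (min_gens S)"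

text \<open>Vectors in $\mathbb{N}^p$ are lists of length $p$, where $p$ is the embedding dimension;
  indices start at 0.\<close>

definition factorizations :: "nat set \<Rightarrow> nat \<Rightarrow> nat list set" where
  "factorizations S s =
     {a. length a = embedding_dim S \<and> (\<Sum>i<embedding_dim S. a ! i * gens S ! i) = s}"

definition lengths :: "nat set \<Rightarrow> nat \<Rightarrow> nat set" where
  "lengths S s = sum_list ` factorizations S s"

text \<open>Minimal generators are nonzero, so each set of lengths is finite and
  \<open>sorted_list_of_set\<close> really lists it.\<close>

definition Delta_elem :: "nat set \<Rightarrow> nat \<Rightarrow> nat set" where
  "Delta_elem S s =
     (let l = sorted_list_of_set (lengths S s)
      in {l ! Suc i - l ! i | i. Suc i < length l})"

definition Delta :: "nat set \<Rightarrow> nat set" where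
  "Delta S = (\<Union>s\<in>S. Delta_elem S s)"

definition meet :: "nat list \<Rightarrow> nat list \<Rightarrow> nat list" where
  "meet x y = map2 min x y"

text \<open>The subtraction does not truncate, as the meet is at most as long as either vector.\<close>

definition fdist :: "nat list \<Rightarrow> nat list \<Rightarrow> nat" where
  "fdist x y = max (sum_list x) (sum_list y) - sum_list (meet x y)"

definition is_chain :: "nat set \<Rightarrow> nat \<Rightarrow> enat \<Rightarrow> nat list list \<Rightarrow> bool" where
  "is_chain S s N zs \<longleftrightarrow>
     zs \<noteq> [] \<and> set zs \<subseteq> factorizations S s \<and> successively (\<lambda>x y. enat (fdist x y) \<le> N) zs"

definition catenary_elem :: "nat set \<Rightarrow> nat \<Rightarrow> enat" where
  "catenary_elem S s =
     (LEAST N. \<forall>x\<in>factorizations S s. \<forall>y\<in>factorizations S s.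
        \<exists>zs. is_chain S s N zs \<and> hd zs = x \<and> last zs = y)"

definition catenary_degree :: "nat set \<Rightarrow> enat" where
  "catenary_degree S = (SUP s\<in>S. catenary_elem S s)"

definition nabla_edges :: "nat set \<Rightarrow> nat \<Rightarrow> (nat list \<times> nat list) set" where
  "nabla_edges S s =
     {(a, b). a \<in> factorizations S s \<and> b \<in> factorizations S s \<and>
        (\<exists>i<embedding_dim S. a ! i \<noteq> 0 \<and> b ! i \<noteq> 0)}"

definition nabla_connected :: "nat set \<Rightarrow> nat \<Rightarrow> bool" where
  "nabla_connected S s \<longleftrightarrow>
     (\<forall>a\<in>factorizations S s. \<forall>b\<in>factorizations S s. (a, b) \<in> (nabla_edges S s)\<^sup>*)"

definition Betti :: "nat set \<Rightarrow> nat set" where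
  "Betti S = {s\<in>S. \<not> nabla_connected S s}"

end

theory Submission
  imports Defs
begin

text \<open>
  Let \<open>n1 < n2 < n3\<close> be the minimal generators, and let \<open>ci\<close> be the least positive integer for
  which \<open>ci * ni\<close> is a combination of the other two generators. By minimality of \<open>ci\<close>, a
  factorization of \<open>ci * ni\<close> that uses \<open>ni\<close> is \<open>ci\<close> copies of \<open>ni\<close> and nothing else
  (\<open>factorization_of_least_multiple\<close>). It is thus an isolated vertex of the graph of
  \<open>ci * ni\<close>, which has a second vertex by the choice of \<open>ci\<close>, so all three numbers \<open>ci * ni\<close>
  are Betti elements. If there is only one Betti element \<open>b\<close>, then
  \<open>c1 * n1 = c2 * n2 = c3 * n3 = b\<close>, whence \<open>c1 > c2 > c3\<close>; and \<open>c3 \<ge> 2\<close> because \<open>n3\<close> is not a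
  combination of \<open>n1\<close> and \<open>n2\<close>.

  The catenary degree is at least \<open>c1\<close>: the factorization \<open>(c1, 0, 0)\<close> of \<open>b\<close> has length \<open>c1\<close> and
  shares no generator with any other factorization of \<open>b\<close>, so every chain that leaves it makes
  a step of size at least \<open>c1\<close> (\<open>catenary_elem_ge_if_isolated\<close>).

  The Delta set is bounded by \<open>M = max (c1 - c2) (c2 - c3)\<close>. Trading \<open>c2\<close> copies of \<open>n2\<close> for
  \<open>c1\<close> copies of \<open>n1\<close> lengthens a factorization by \<open>c1 - c2\<close>, and trading \<open>c3\<close> copies of \<open>n3\<close>
  for \<open>c2\<close> copies of \<open>n2\<close> lengthens it by \<open>c2 - c3\<close>. A factorization that admits neither
  exchange is already a longest one (\<open>longest_if_small_coefficients\<close>), so from any other length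
  a longer one is reached within distance \<open>M\<close>.

  Finally \<open>c1 > c2 > c3 \<ge> 2\<close> gives \<open>M + 2 < c1\<close>: both \<open>c1 - (c1 - c2) = c2 \<ge> 3\<close> and
  \<open>(c2 - c3) + 2 \<le> c2 < c1\<close>.
\<close>

section \<open>Least multiples that are combinations of two other numbers\<close>

definition least_mult :: "nat \<Rightarrow> nat \<Rightarrow> nat \<Rightarrow> nat" where
  "least_mult n a b = (LEAST k. 0 < k \<and> (\<exists>u v. k * n = u * a + v * b))"

lemma least_mult_attained:
  assumes "0 < a"
  shows least_mult_pos: "0 < least_mult n a b"
    and least_mult_eq: "\<exists>u v. least_mult n a b * n = u * a + v * b"
proof -
  have "a * n = n * a + 0 * b" by simp
  with assms have "\<exists>k. 0 < k \<and> (\<exists>u v. k * n = u * a + v * b)" by blast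
  from LeastI_ex[OF this]
  show "0 < least_mult n a b" "\<exists>u v. least_mult n a b * n = u * a + v * b"
    unfolding least_mult_def by auto
qed

lemma least_mult_le: "0 < k \<Longrightarrow> k * n = u * a + v * b \<Longrightarrow> least_mult n a b \<le> k"
  unfolding least_mult_def by (rule Least_le) blast

lemma least_mult_commute: "least_mult n a b = least_mult n b a"
  unfolding least_mult_def by (metis add.commute)

text \<open>If \<open>x\<close> were smaller than the least multiplier, cancelling \<open>x * n\<close> would leave a smaller positive
  multiple of \<open>n\<close> that is a combination of \<open>a\<close> and \<open>b\<close>; otherwise \<open>x * n\<close> exhausts the sum.\<close>

lemma factorization_of_least_multiple:
  assumes "0 < n" "0 < a" "0 < b" "0 < x" and eq: "x * n + u * a + v * b = least_mult n a b * n"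
  shows "x = least_mult n a b \<and> u = 0 \<and> v = 0"
proof (cases "x < least_mult n a b")
  case True
  then have "(least_mult n a b - x) * n = u * a + v * b"
    using eq by (simp add: diff_mult_distrib)
  with True \<open>0 < x\<close> have False
    using least_mult_le[of "least_mult n a b - x"] by fastforce
  then show ?thesis ..
next
  case False
  then have le: "least_mult n a b * n \<le> x * n" by simp
  with eq have "u * a + v * b = 0" by linarith
  with assms have uv: "u = 0" "v = 0" by auto
  with eq \<open>0 < n\<close> show ?thesis by simp
qed

text \<open>The descent behind the bound on the Delta set. In a relation \<open>p * n2 = m * n1 + k * n3\<close> with
  \<open>0 < k < c3\<close>, the multiplier \<open>p\<close> is at least \<open>c2\<close>; exchanging \<open>c2\<close> copies of \<open>n2\<close> for \<open>c3\<close>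
  copies of \<open>n3\<close> and cancelling turns the relation into one whose left side is \<open>m * n1\<close>, so
  \<open>m \<ge> c1\<close> as well. Removing the common value \<open>c1 * n1 = c2 * n2\<close> from both sides gives a
  smaller relation with the same \<open>k\<close>.\<close>

lemma no_small_coefficient:
  fixes n1 n2 n3 :: nat
  assumes pos: "0 < n1" "0 < n2" "0 < n3"
    and least: "c1 = least_mult n1 n2 n3" "c2 = least_mult n2 n1 n3" "c3 = least_mult n3 n1 n2"
    and eq: "c1 * n1 = c2 * n2" "c2 * n2 = c3 * n3"
    and k: "0 < k" "k < c3"
  shows "p * n2 \<noteq> m * n1 + k * n3"
proof (induction p arbitrary: m rule: less_induct)
  case (less p)
  show ?case
  proof
    assume h: "p * n2 = m * n1 + k * n3"
    with k pos have "0 < p" by (cases p) auto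
    with h have p: "c2 \<le> p" using least least_mult_le by blast
    have c2: "0 < c2" using least least_mult_pos pos by blast
    have "c3 * n3 = (c3 - k) * n3 + k * n3"
      using k by (simp flip: add_mult_distrib)
    moreover have "p * n2 = (p - c2) * n2 + c2 * n2"
      using p by (simp flip: add_mult_distrib)
    ultimately have h2: "m * n1 = (p - c2) * n2 + (c3 - k) * n3"
      using h eq by linarith
    with k pos have "0 < m" by (cases m) auto
    with h2 have "c1 \<le> m" using least least_mult_le by blast
    then have "m * n1 = (m - c1) * n1 + c1 * n1"
      by (simp flip: add_mult_distrib)
    with h p have "(p - c2) * n2 = (m - c1) * n1 + k * n3"
      using eq \<open>p * n2 = (p - c2) * n2 + c2 * n2\<close> by linarith
    with less[of "p - c2" "m - c1"] p c2 show False by auto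
  qed
qed

text \<open>No other factorization can have fewer copies of \<open>n2\<close> or of \<open>n3\<close>: after cancelling common
  copies, the missing \<open>k\<close> copies would sit in a relation that is excluded by positivity, by
  minimality of \<open>c2\<close> or \<open>c3\<close>, or by \<open>no_small_coefficient\<close>. Hence passing to another factorization
  only replaces copies of \<open>n1\<close> by copies of the larger generators, which cannot increase the
  length.\<close>

lemma longest_if_small_coefficients:
  fixes n1 n2 n3 :: nat
  assumes pos: "0 < n1" "n1 < n2" "n2 < n3"
    and least: "c1 = least_mult n1 n2 n3" "c2 = least_mult n2 n1 n3" "c3 = least_mult n3 n1 n2"
    and eq: "c1 * n1 = c2 * n2" "c2 * n2 = c3 * n3"
    and small: "x2 < c2" "x3 < c3"
    and same: "x1 * n1 + x2 * n2 + x3 * n3 = y1 * n1 + y2 * n2 + y3 * n3"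
  shows "y1 + y2 + y3 \<le> x1 + x2 + x3"
proof -
  note comm = least_mult_commute
  have d2: "x2 \<le> y2"
  proof (rule ccontr)
    assume "\<not> x2 \<le> y2"
    define k where "k = x2 - y2"
    then have k: "x2 = y2 + k" "0 < k" "k < c2" using \<open>\<not> x2 \<le> y2\<close> small by auto
    have same': "x1 * n1 + k * n2 + x3 * n3 = y1 * n1 + y3 * n3"
      using same k by (simp add: add_mult_distrib)
    have no3: "p * n3 \<noteq> m * n1 + k * n2" for p m
      by (rule no_small_coefficient[of n1 n3 n2 c1 c3 c2]) (use pos least eq k comm in auto)
    have no1: "p * n1 \<noteq> m * n3 + k * n2" for p m
      by (rule no_small_coefficient[of n3 n1 n2 c3 c1 c2]) (use pos least eq k comm in auto)
    consider "y1 \<le> x1" "y3 \<le> x3" | "y1 \<le> x1" "x3 \<le> y3" | "x1 \<le> y1" "y3 \<le> x3"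
      | "x1 \<le> y1" "x3 \<le> y3" by linarith
    then show False
    proof cases
      case 1
      then have "y1 * n1 \<le> x1 * n1" "y3 * n3 \<le> x3 * n3" by auto
      moreover have "0 < k * n2" using k pos by simp
      ultimately show False using same' by linarith
    next
      case 2
      then obtain a b where "x1 = y1 + a" "y3 = x3 + b" using le_Suc_ex by metis
      with same' have "b * n3 = a * n1 + k * n2" by (simp add: add_mult_distrib)
      with no3 show False by blast
    next
      case 3
      then obtain a b where "y1 = x1 + a" "x3 = y3 + b" using le_Suc_ex by metis
      with same' have "a * n1 = b * n3 + k * n2" by (simp add: add_mult_distrib)
      with no1 show False by blast
    next
      case 4
      then obtain a b where "y1 = x1 + a" "y3 = x3 + b" using le_Suc_ex by metis
      with same' have "k * n2 = a * n1 + b * n3" by (simp add: add_mult_distrib)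
      then have "c2 \<le> k" using least least_mult_le k by blast
      with k show False by simp
    qed
  qed
  have d3: "x3 \<le> y3"
  proof (rule ccontr)
    assume "\<not> x3 \<le> y3"
    define k where "k = x3 - y3"
    then have k: "x3 = y3 + k" "0 < k" "k < c3" using \<open>\<not> x3 \<le> y3\<close> small by auto
    obtain b where b: "y2 = x2 + b" using d2 le_Suc_ex by metis
    have same': "x1 * n1 + k * n3 = y1 * n1 + b * n2"
      using same k b by (simp add: add_mult_distrib)
    show False
    proof (cases "y1 \<le> x1")
      case True
      then obtain a where "x1 = y1 + a" using le_Suc_ex by metis
      with same' have "b * n2 = a * n1 + k * n3" by (simp add: add_mult_distrib)
      with no_small_coefficient[of n1 n2 n3 c1 c2 c3 k b a] show False
        using pos least eq k by auto
    next
      case False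
      then obtain a where "y1 = x1 + a" using le_Suc_ex nat_le_linear by metis
      with same' have "k * n3 = a * n1 + b * n2" by (simp add: add_mult_distrib)
      then have "c3 \<le> k" using least least_mult_le k by blast
      with k show False by simp
    qed
  qed
  \<comment> \<open>\<open>n1\<close> is the smallest generator, so the copies gained cost at least as many copies of \<open>n1\<close>.\<close>
  obtain a b where ab: "y2 = x2 + a" "y3 = x3 + b" using d2 d3 le_Suc_ex by metis
  have eq': "x1 * n1 = y1 * n1 + a * n2 + b * n3"
    using same ab by (simp add: add_mult_distrib)
  also have "\<dots> \<ge> (y1 + a + b) * n1"
    using pos by (simp add: add_mult_distrib add_mono)
  finally have "y1 + a + b \<le> x1" using pos by simp
  with ab show ?thesis by simp
qed

section \<open>Minimal generators and coordinates of factorizations\<close>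

lemma submonoid_hull: "submonoid (submonoid hull A)"
  unfolding hull_def submonoid_def by blast

lemma mult_mem_submonoid: "submonoid T \<Longrightarrow> x \<in> T \<Longrightarrow> k * x \<in> T"
  by (induction k) (auto simp: submonoid_def)

lemma min_gens_irredundant:
  assumes S: "numerical_semigroup S" and n: "n \<in> min_gens S"
  shows "n \<notin> submonoid hull (min_gens S - {n})"
proof
  let ?B = "min_gens S - {n}"
  assume n': "n \<in> submonoid hull ?B"
  have gen: "is_min_gens S (min_gens S)"
    unfolding min_gens_def by (rule theI'[OF ex1_is_min_gens[OF S]])
  have "min_gens S \<subseteq> submonoid hull ?B"
    using n' hull_inc[of _ ?B submonoid] by blast
  then have "submonoid hull (min_gens S) \<subseteq> submonoid hull ?B"
    by (rule hull_minimal) (rule submonoid_hull)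
  moreover have "submonoid hull ?B \<subseteq> submonoid hull (min_gens S)"
    by (rule hull_mono) blast
  ultimately have "submonoid hull ?B = S"
    using gen unfolding is_min_gens_def by blast
  moreover have "?B \<subset> min_gens S" using n by blast
  ultimately show False using gen unfolding is_min_gens_def by blast
qed

lemma min_gens_subset:
  assumes S: "numerical_semigroup S"
  shows "min_gens S \<subseteq> S"
proof -
  have "is_min_gens S (min_gens S)"
    unfolding min_gens_def by (rule theI'[OF ex1_is_min_gens[OF S]])
  then show ?thesis using hull_subset unfolding is_min_gens_def by metis
qed

lemma obtain_three_gens:
  assumes S: "numerical_semigroup S" and dim: "embedding_dim S = 3"
  obtains n1 n2 n3 where "gens S = [n1, n2, n3]" "min_gens S = {n1, n2, n3}"
    "0 < n1" "n1 < n2" "n2 < n3"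
proof -
  have fin: "finite (min_gens S)" and card: "card (min_gens S) = 3"
    using dim unfolding embedding_dim_def by (auto intro: card_ge_0_finite)
  have "length (gens S) = 3"
    unfolding gens_def using card by simp
  then obtain n1 n2 n3 where g: "gens S = [n1, n2, n3]"
    by (auto simp: eval_nat_numeral length_Suc_conv)
  have set: "min_gens S = {n1, n2, n3}"
    using set_sorted_list_of_set[OF fin] g unfolding gens_def by simp
  have "sorted_wrt (<) (gens S)"
    unfolding gens_def by (rule strict_sorted_list_of_set)
  with g have less: "n1 < n2" "n2 < n3" by auto
  have "0 \<in> submonoid hull (min_gens S - {0})"
    using submonoid_hull unfolding submonoid_def by blast
  then have "0 \<notin> min_gens S" using min_gens_irredundant[OF S] by blast
  then have "0 < n1" using set by auto
  with g set less show ?thesis using that by blast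
qed

lemma mem_factorizations_three:
  assumes "gens S = [n1, n2, n3]" "embedding_dim S = 3"
  shows "z \<in> factorizations S s \<longleftrightarrow>
    (\<exists>x1 x2 x3. z = [x1, x2, x3] \<and> x1 * n1 + x2 * n2 + x3 * n3 = s)"
proof -
  have "length z = 3 \<longleftrightarrow> (\<exists>x1 x2 x3. z = [x1, x2, x3])"
    by (auto simp: eval_nat_numeral length_Suc_conv)
  then show ?thesis
    unfolding factorizations_def assms by (auto simp: eval_nat_numeral)
qed

section \<open>Isolated factorizations\<close>

lemma not_nabla_connected_if_isolated:
  assumes "z \<in> factorizations S s" "z' \<in> factorizations S s" "z' \<noteq> z"
    and isol: "\<And>y i. y \<in> factorizations S s \<Longrightarrow> i < embedding_dim S \<Longrightarrow> z ! i \<noteq> 0 \<Longrightarrow> y ! i \<noteq> 0 \<Longrightarrow> y = z"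
  shows "\<not> nabla_connected S s"
proof
  assume "nabla_connected S s"
  then have "(z, z') \<in> (nabla_edges S s)\<^sup>*"
    using assms unfolding nabla_connected_def by blast
  then have "z' = z"
    by (induction rule: rtrancl_induct) (use isol in \<open>auto simp: nabla_edges_def\<close>)
  with \<open>z' \<noteq> z\<close> show False ..
qed

text \<open>A chain from \<open>z\<close> to \<open>z'\<close> leaves \<open>z\<close> at some point, and that step has size at least \<open>M\<close>.\<close>

lemma catenary_elem_ge_if_isolated:
  assumes z: "z \<in> factorizations S s" and z': "z' \<in> factorizations S s" "z' \<noteq> z"
    and far: "\<And>y. y \<in> factorizations S s \<Longrightarrow> y \<noteq> z \<Longrightarrow> M \<le> fdist z y"
  shows "enat M \<le> catenary_elem S s"
proof -
  let ?P = "\<lambda>N. \<forall>x\<in>factorizations S s. \<forall>y\<in>factorizations S s.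
    \<exists>zs. is_chain S s N zs \<and> hd zs = x \<and> last zs = y"
  have "\<exists>zs. is_chain S s \<infinity> zs \<and> hd zs = x \<and> last zs = y"
    if "x \<in> factorizations S s" "y \<in> factorizations S s" for x y
    by (rule exI[of _ "[x, y]"]) (use that in \<open>simp add: is_chain_def\<close>)
  \<comment> \<open>Any value at all with the chain property makes the least one have it too.\<close>
  then have "?P \<infinity>" by blast
  then have P: "?P (catenary_elem S s)"
    unfolding catenary_elem_def by (rule LeastI[of ?P])
  with z z' obtain zs where zs: "is_chain S s (catenary_elem S s) zs" "hd zs = z" "last zs = z'"
    by blast
  have "enat M \<le> N" if "is_chain S s N zs" "hd zs = z" "last zs = z'" for N zs
    using that
  proof (induction zs rule: induct_list012)
    case (3 x y zs)
    then have xy: "y \<in> factorizations S s" "x = z" "enat (fdist x y) \<le> N"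
      by (auto simp: is_chain_def)
    show ?case
    proof (cases "y = z")
      case True
      then show ?thesis using 3 by (auto simp: is_chain_def)
    next
      case False
      with far xy have "enat M \<le> enat (fdist x y)" by simp
      with xy show ?thesis by (meson order_trans)
    qed
  qed (use \<open>z' \<noteq> z\<close> in \<open>auto simp: is_chain_def\<close>)
  with zs show ?thesis by blast
qed

section \<open>Gaps between lengths\<close>

text \<open>It suffices to find some longer factorization within distance \<open>M\<close> of each one that is not
  longest: the next length after that of \<open>x\<close> is at most that of \<open>x'\<close>.\<close>

lemma Delta_elem_le_if_longer:
  assumes "d \<in> Delta_elem S s"
    and longer: "\<And>x y. x \<in> factorizations S s \<Longrightarrow> y \<in> factorizations S s
      \<Longrightarrow> sum_list x < sum_list y
      \<Longrightarrow> \<exists>x'\<in>factorizations S s. sum_list x < sum_list x' \<and> sum_list x' \<le> sum_list x + M"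
  shows "d \<le> M"
proof -
  define l where "l = sorted_list_of_set (lengths S s)"
  obtain i where i: "d = l ! Suc i - l ! i" "Suc i < length l"
    using assms(1) unfolding Delta_elem_def l_def by (auto simp: Let_def)
  have sorted: "sorted_wrt (<) l"
    unfolding l_def by (rule strict_sorted_list_of_set)
  have "finite (lengths S s)"
  proof (rule ccontr)
    assume "infinite (lengths S s)"
    \<comment> \<open>An infinite set is listed as the empty list, which has no gaps.\<close>
    then show False using i unfolding l_def by simp
  qed
  then have set: "set l = lengths S s"
    unfolding l_def by simp
  have lt: "l ! i < l ! Suc i" using sorted i by (simp add: sorted_wrt_nth_less)
  have "l ! i \<in> lengths S s" "l ! Suc i \<in> lengths S s"
    using set i nth_mem[of i l] nth_mem[of "Suc i" l] by auto
  then obtain x y where xy: "x \<in> factorizations S s" "y \<in> factorizations S s"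
      "sum_list x = l ! i" "sum_list y = l ! Suc i"
    unfolding lengths_def by auto
  with lt longer[of x y] obtain x' where x': "x' \<in> factorizations S s"
      "l ! i < sum_list x'" "sum_list x' \<le> l ! i + M" by auto
  then have "sum_list x' \<in> set l" using set unfolding lengths_def by blast
  then obtain j where j: "j < length l" "l ! j = sum_list x'"
    by (auto simp: in_set_conv_nth)
  have "i < j"
  proof (rule ccontr)
    assume "\<not> i < j"
    then have "l ! j \<le> l ! i"
      using sorted i strict_sorted_imp_sorted sorted_nth_mono[of l j i] by auto
    with j x' show False by simp
  qed
  then have "l ! Suc i \<le> l ! j"
    using sorted j strict_sorted_imp_sorted sorted_nth_mono[of l "Suc i" j] by auto
  with j x' i show "d \<le> M" by simp
qed

lemma Delta_elem_nonempty:
  assumes fin: "finite (lengths S s)" and two: "l1 \<in> lengths S s" "l2 \<in> lengths S s" "l1 \<noteq> l2"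
  shows "Delta_elem S s \<noteq> {}"
proof -
  have "card {l1, l2} \<le> card (lengths S s)" using fin two by (intro card_mono) auto
  then have "Suc 0 < length (sorted_list_of_set (lengths S s))" using two by simp
  then show ?thesis unfolding Delta_elem_def by (auto simp: Let_def)
qed

section \<open>Semigroups with a single Betti element\<close>

theorem theorem3p5:
  fixes S :: "nat set"
  assumes "numerical_semigroup S"
    and "embedding_dim S = 3"
    and "card (Betti S) = 1"
  shows "enat (Max (Delta S) + 2) < catenary_degree S"
proof -
  note S = assms(1) and dim = assms(2)
  obtain n1 n2 n3 where g: "gens S = [n1, n2, n3]" and set: "min_gens S = {n1, n2, n3}"
    and n: "0 < n1" "n1 < n2" "n2 < n3"
    using obtain_three_gens[OF S dim] by blast
  note fact = mem_factorizations_three[OF g dim]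
  have less3: "i < embedding_dim S \<longleftrightarrow> i = 0 \<or> i = 1 \<or> i = 2" for i
    using dim by auto
  have mono: "submonoid S" using S unfolding numerical_semigroup_def by blast
  have gS: "n1 \<in> S" "n2 \<in> S" "n3 \<in> S"
    using min_gens_subset[OF S] set by auto
  define c1 where "c1 = least_mult n1 n2 n3"
  define c2 where "c2 = least_mult n2 n1 n3"
  define c3 where "c3 = least_mult n3 n1 n2"
  have c_pos: "0 < c1" "0 < c2" "0 < c3"
    using n by (auto simp: c1_def c2_def c3_def intro: least_mult_pos)
  have isol1: "y = [c1, 0, 0]" if y: "y \<in> factorizations S (c1 * n1)" "y ! 0 \<noteq> 0" for y
  proof -
    obtain x1 x2 x3 where x: "y = [x1, x2, x3]" "x1 * n1 + x2 * n2 + x3 * n3 = c1 * n1"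
      using y(1) unfolding fact by blast
    have "x1 = c1 \<and> x2 = 0 \<and> x3 = 0"
      unfolding c1_def by (rule factorization_of_least_multiple)
        (use x y(2) n in \<open>auto simp: c1_def\<close>)
    with x show ?thesis by simp
  qed
  have isol2: "y = [0, c2, 0]" if y: "y \<in> factorizations S (c2 * n2)" "y ! 1 \<noteq> 0" for y
  proof -
    obtain x1 x2 x3 where x: "y = [x1, x2, x3]" "x1 * n1 + x2 * n2 + x3 * n3 = c2 * n2"
      using y(1) unfolding fact by blast
    have "x2 = c2 \<and> x1 = 0 \<and> x3 = 0"
      unfolding c2_def by (rule factorization_of_least_multiple)
        (use x y(2) n in \<open>auto simp: c2_def\<close>)
    with x show ?thesis by simp
  qed
  have isol3: "y = [0, 0, c3]" if y: "y \<in> factorizations S (c3 * n3)" "y ! 2 \<noteq> 0" for y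
  proof -
    obtain x1 x2 x3 where x: "y = [x1, x2, x3]" "x1 * n1 + x2 * n2 + x3 * n3 = c3 * n3"
      using y(1) unfolding fact by blast
    have "x3 = c3 \<and> x1 = 0 \<and> x2 = 0"
      unfolding c3_def by (rule factorization_of_least_multiple)
        (use x y(2) n in \<open>auto simp: c3_def\<close>)
    with x show ?thesis by simp
  qed
  have B1: "c1 * n1 \<in> Betti S"
  proof -
    obtain u v where "c1 * n1 = u * n2 + v * n3"
      unfolding c1_def using least_mult_eq n by (meson less_trans)
    then have "[c1, 0, 0] \<in> factorizations S (c1 * n1)" "[0, u, v] \<in> factorizations S (c1 * n1)"
      unfolding fact by auto
    then have "\<not> nabla_connected S (c1 * n1)"
      by (rule not_nabla_connected_if_isolated)
        (use c_pos isol1 in \<open>auto simp: less3\<close>)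
    then show ?thesis using mult_mem_submonoid[OF mono gS(1)] unfolding Betti_def by simp
  qed
  have B2: "c2 * n2 \<in> Betti S"
  proof -
    obtain u v where "c2 * n2 = u * n1 + v * n3"
      unfolding c2_def using least_mult_eq n by blast
    then have "[0, c2, 0] \<in> factorizations S (c2 * n2)" "[u, 0, v] \<in> factorizations S (c2 * n2)"
      unfolding fact by auto
    then have "\<not> nabla_connected S (c2 * n2)"
      by (rule not_nabla_connected_if_isolated)
        (use c_pos isol2 in \<open>auto simp: less3\<close>)
    then show ?thesis using mult_mem_submonoid[OF mono gS(2)] unfolding Betti_def by simp
  qed
  have B3: "c3 * n3 \<in> Betti S"
  proof -
    obtain u v where "c3 * n3 = u * n1 + v * n2"
      unfolding c3_def using least_mult_eq n by blast
    then have "[0, 0, c3] \<in> factorizations S (c3 * n3)" "[u, v, 0] \<in> factorizations S (c3 * n3)"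
      unfolding fact by auto
    then have "\<not> nabla_connected S (c3 * n3)"
      by (rule not_nabla_connected_if_isolated)
        (use c_pos isol3 in \<open>auto simp: less3\<close>)
    then show ?thesis using mult_mem_submonoid[OF mono gS(3)] unfolding Betti_def by simp
  qed
  obtain e where "Betti S = {e}" using assms(3) card_1_singletonE by blast
  with B1 B2 B3 have eq: "c1 * n1 = c2 * n2" "c2 * n2 = c3 * n3" by auto
  have "c2 * n1 < c2 * n2" "c3 * n2 < c3 * n3" using c_pos n by auto
  with eq have "c2 * n1 < c1 * n1" "c3 * n2 < c2 * n2" by auto
  then have less: "c2 < c1" "c3 < c2" by auto
  have "c3 \<noteq> 1"
  proof
    assume "c3 = 1"
    then obtain u v where uv: "n3 = u * n1 + v * n2"
      unfolding c3_def using least_mult_eq[of n1 n3 n2] n by auto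
    let ?T = "submonoid hull (min_gens S - {n3})"
    have "n1 \<in> ?T" "n2 \<in> ?T" using set n by (auto intro!: hull_inc)
    then have "u * n1 \<in> ?T" "v * n2 \<in> ?T"
      by (auto intro: mult_mem_submonoid submonoid_hull)
    moreover have "x + y \<in> ?T" if "x \<in> ?T" "y \<in> ?T" for x y
      using submonoid_hull[of "min_gens S - {n3}"] that by (subst (asm) submonoid_def) blast
    ultimately have "n3 \<in> ?T" unfolding uv by blast
    moreover have "n3 \<in> min_gens S" using set by simp
    ultimately show False using min_gens_irredundant[OF S] by simp
  qed
  with c_pos less have c: "2 \<le> c3" "c3 < c2" "c2 < c1" by auto

  define M where "M = max (c1 - c2) (c2 - c3)"
  have M: "M + 2 < c1" using c unfolding M_def by auto
  have "d \<le> M" if "d \<in> Delta_elem S s" for d s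
    using that
  proof (rule Delta_elem_le_if_longer)
    fix x y
    assume "x \<in> factorizations S s" "y \<in> factorizations S s" and lt: "sum_list x < sum_list y"
    then obtain x1 x2 x3 y1 y2 y3 where
      x: "x = [x1, x2, x3]" "x1 * n1 + x2 * n2 + x3 * n3 = s" and
      y: "y = [y1, y2, y3]" "y1 * n1 + y2 * n2 + y3 * n3 = s"
      unfolding fact by blast
    have "\<not> (x2 < c2 \<and> x3 < c3)"
      using longest_if_small_coefficients[OF n c1_def c2_def c3_def eq, of x2 x3 x1 y1 y2 y3]
        x y lt by auto
    then consider "c2 \<le> x2" | "c3 \<le> x3" by linarith
    then show "\<exists>x'\<in>factorizations S s. sum_list x < sum_list x' \<and> sum_list x' \<le> sum_list x + M"
    proof cases
      case 1
      then obtain a where a: "x2 = c2 + a" using le_Suc_ex by metis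
      have "[x1 + c1, a, x3] \<in> factorizations S s"
        unfolding fact using x a eq by (simp add: add_mult_distrib)
      then show ?thesis
        by (rule bexI[rotated]) (use x a c in \<open>auto simp: M_def\<close>)
    next
      case 2
      then obtain a where a: "x3 = c3 + a" using le_Suc_ex by metis
      have "[x1, x2 + c2, a] \<in> factorizations S s"
        unfolding fact using x a eq by (simp add: add_mult_distrib)
      then show ?thesis
        by (rule bexI[rotated]) (use x a c in \<open>auto simp: M_def\<close>)
    qed
  qed
  then have Delta_le: "d \<le> M" if "d \<in> Delta S" for d
    using that unfolding Delta_def by blast

  \<comment> \<open>The Betti element has the lengths \<open>c1\<close> and \<open>c2\<close>, so the Delta set is nonempty and its
    maximum is attained.\<close>
  define b where "b = c1 * n1"
  have bS: "b \<in> S" using B1 unfolding b_def Betti_def by simp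
  have b1: "[c1, 0, 0] \<in> factorizations S b" and b2: "[0, c2, 0] \<in> factorizations S b"
    unfolding fact b_def using eq by auto
  have "lengths S b \<subseteq> {..b}"
  proof
    fix l assume "l \<in> lengths S b"
    then obtain x1 x2 x3 where x: "l = x1 + x2 + x3" "x1 * n1 + x2 * n2 + x3 * n3 = b"
      unfolding lengths_def using fact by force
    have "x1 \<le> x1 * n1" "x2 \<le> x2 * n2" "x3 \<le> x3 * n3"
      using n by simp_all
    with x have "l \<le> b" by linarith
    then show "l \<in> {..b}" by simp
  qed
  then have "finite (lengths S b)" by (rule finite_subset) simp
  moreover have "c1 \<in> lengths S b" "c2 \<in> lengths S b"
    using imageI[OF b1, of sum_list] imageI[OF b2, of sum_list] unfolding lengths_def by auto
  ultimately have "Delta_elem S b \<noteq> {}" using c Delta_elem_nonempty by blast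
  then have "Delta S \<noteq> {}" using bS unfolding Delta_def by blast
  moreover have "finite (Delta S)"
    by (rule finite_subset[of _ "{..M}"]) (use Delta_le in auto)
  ultimately have "Max (Delta S) \<le> M" using Delta_le by simp
  with M have "Max (Delta S) + 2 < c1" by simp
  moreover have "enat c1 \<le> catenary_elem S b"
  proof (rule catenary_elem_ge_if_isolated[OF b1 b2])
    show "[0, c2, 0] \<noteq> [c1, 0, 0]" using c by simp
    fix y assume y: "y \<in> factorizations S b" "y \<noteq> [c1, 0, 0]"
    then have "y ! 0 = 0" using isol1 unfolding b_def by blast
    moreover obtain y1 y2 y3 where "y = [y1, y2, y3]" using y(1) fact by blast
    ultimately show "c1 \<le> fdist [c1, 0, 0] y" by (simp add: fdist_def meet_def)
  qed
  ultimately have "enat (Max (Delta S) + 2) < catenary_elem S b"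
    by (meson enat_ord_simps(2) less_le_trans)
  also have "\<dots> \<le> catenary_degree S"
    unfolding catenary_degree_def using bS by (rule SUP_upper)
  finally show ?thesis .
qed

end
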